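(* Let $M=(M,d_M)$ and $N=(N,d_N)$ be complete filtered chain complexes and let $F:M\to N$ and $G:N\to M$ be (filtration-preserving) chain maps that are chain homotopy inverse to each other. Given a perturbation $\tilde d_M$ of the differential $d_M$, there are perturbations $\tilde d_N$, $\tilde F$ and $\tilde G$ of $d_N$, $F$ and $G$ such that $\tilde d_N$ is a differential and $\tilde F:(M,\tilde d_M)\to(N,\tilde d_N)$ and $\tilde G:(N,\tilde d_N)\to(M,\tilde d_M)$ are chain maps with respect to the perturbed differentials, chain homotopy inverse to each other.
   Context: Chain complexes are $\mathbb Z$-graded complexes of abelian groups with differential of degree $-1$. A filtration of a chain complex $M$ is a descending sequence $M=F^0M\supset F^1M\supset\cdots$ of subcomplexes; it is complete if (in each degree) $M\to\varprojlim_p M/F^pM$ is an isomorphism. Maps of filtered complexes, including chain homotopies, are required to preserve filtrations. A linear map $g:M\to N$ is a perturbation of $f:M\to N$ of the same degree if $(f-g)(F^pM)\subset F^{p+1}N$ for all $p\ge0$. A perturbation of a differential $d$ is a perturbation $\tilde d$ of the map $d$ with $\tilde d^2=0$. *)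

theory Defs
  imports "HOL-Algebra.AbelCoset" "HOL-Algebra.Product_Groups"
begin

text \<open>
  A graded abelian group is a family \<open>M :: int \<Rightarrow> _ ring_scheme\<close> with each \<open>M n\<close> an
  \<^locale>\<open>abelian_group\<close>, so only the additive structure of the records matters. A map of
  degree \<open>k\<close> is a family of homomorphisms \<open>f n\<close> from \<open>M n\<close> to \<open>N (n + k)\<close>; values outside the
  carriers are irrelevant. A filtration is a family \<open>F p n\<close>, the \<open>p\<close>-th filtration step in
  degree \<open>n\<close>.
\<close>

definition graded_map ::
  "(int \<Rightarrow> ('a, 'm) ring_scheme) \<Rightarrow> (int \<Rightarrow> ('b, 'n) ring_scheme) \<Rightarrow> int \<Rightarrow> (int \<Rightarrow> 'a \<Rightarrow> 'b) \<Rightarrow> bool"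
  where "graded_map M N k f \<longleftrightarrow> (\<forall>n. abelian_group_hom (M n) (N (n + k)) (f n))"

definition preserves_filtration ::
  "(nat \<Rightarrow> int \<Rightarrow> 'a set) \<Rightarrow> (nat \<Rightarrow> int \<Rightarrow> 'b set) \<Rightarrow> int \<Rightarrow> (int \<Rightarrow> 'a \<Rightarrow> 'b) \<Rightarrow> bool"
  where "preserves_filtration FM FN k f \<longleftrightarrow> (\<forall>p n. f n ` FM p n \<subseteq> FN p (n + k))"

definition is_differential ::
  "(int \<Rightarrow> ('a, 'm) ring_scheme) \<Rightarrow> (int \<Rightarrow> 'a \<Rightarrow> 'a) \<Rightarrow> bool"
  where "is_differential M d \<longleftrightarrow> graded_map M M (-1) d \<and>
    (\<forall>n. \<forall>x\<in>carrier (M n). d (n - 1) (d n x) = \<zero>\<^bsub>M (n - 2)\<^esub>)"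

text \<open>
  The inverse limit of the quotients \<open>A / F p\<close> as a subgroup of their product. The transition
  map from \<open>A / F (Suc p)\<close> to \<open>A / F p\<close> sends a coset \<open>C\<close> to the coset \<open>F p + C\<close>.
\<close>

definition quotient_limit :: "('a, 'm) ring_scheme \<Rightarrow> (nat \<Rightarrow> 'a set) \<Rightarrow> (nat \<Rightarrow> 'a set) monoid"
  where "quotient_limit A F =
    (product_group UNIV (\<lambda>p. A A_Mod F p))
      \<lparr>carrier := {X \<in> carrier (product_group UNIV (\<lambda>p. A A_Mod F p)).
                     \<forall>p. F p <+>\<^bsub>A\<^esub> X (Suc p) = X p}\<rparr>"

locale filtered_complex =
  fixes M :: "int \<Rightarrow> ('a, 'm) ring_scheme"
    and d :: "int \<Rightarrow> 'a \<Rightarrow> 'a"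
    and F :: "nat \<Rightarrow> int \<Rightarrow> 'a set"
  assumes abelian: "abelian_group (M n)"
    and differential: "is_differential M d"
    and filtration_subgroup: "additive_subgroup (F p n) (M n)"
    and filtration_0: "F 0 n = carrier (M n)"
    and filtration_descending: "F (Suc p) n \<subseteq> F p n"
    and filtration_differential: "preserves_filtration F F (-1) d"

locale complete_filtered_complex = filtered_complex +
  assumes complete:
    "(\<lambda>x p. F p n +>\<^bsub>M n\<^esub> x) \<in> iso (add_monoid (M n)) (quotient_limit (M n) (\<lambda>p. F p n))"

definition is_perturbation ::
  "(int \<Rightarrow> ('a, 'm) ring_scheme) \<Rightarrow> (nat \<Rightarrow> int \<Rightarrow> 'a set) \<Rightarrow>
   (int \<Rightarrow> ('b, 'n) ring_scheme) \<Rightarrow> (nat \<Rightarrow> int \<Rightarrow> 'b set) \<Rightarrow>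
   int \<Rightarrow> (int \<Rightarrow> 'a \<Rightarrow> 'b) \<Rightarrow> (int \<Rightarrow> 'a \<Rightarrow> 'b) \<Rightarrow> bool"
  where "is_perturbation M FM N FN k f g \<longleftrightarrow> graded_map M N k g \<and>
    (\<forall>p n. \<forall>x\<in>FM p n. f n x \<ominus>\<^bsub>N (n + k)\<^esub> g n x \<in> FN (Suc p) (n + k))"

definition is_differential_perturbation ::
  "(int \<Rightarrow> ('a, 'm) ring_scheme) \<Rightarrow> (nat \<Rightarrow> int \<Rightarrow> 'a set) \<Rightarrow>
   (int \<Rightarrow> 'a \<Rightarrow> 'a) \<Rightarrow> (int \<Rightarrow> 'a \<Rightarrow> 'a) \<Rightarrow> bool"
  where "is_differential_perturbation M F d d' \<longleftrightarrow>
    is_perturbation M F M F (-1) d d' \<and> is_differential M d'"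

definition filtered_chain_map ::
  "(int \<Rightarrow> ('a, 'm) ring_scheme) \<Rightarrow> (int \<Rightarrow> 'a \<Rightarrow> 'a) \<Rightarrow> (nat \<Rightarrow> int \<Rightarrow> 'a set) \<Rightarrow>
   (int \<Rightarrow> ('b, 'n) ring_scheme) \<Rightarrow> (int \<Rightarrow> 'b \<Rightarrow> 'b) \<Rightarrow> (nat \<Rightarrow> int \<Rightarrow> 'b set) \<Rightarrow>
   (int \<Rightarrow> 'a \<Rightarrow> 'b) \<Rightarrow> bool"
  where "filtered_chain_map M dM FM N dN FN f \<longleftrightarrow>
    graded_map M N 0 f \<and> preserves_filtration FM FN 0 f \<and>
    (\<forall>n. \<forall>x\<in>carrier (M n). dN n (f n x) = f (n - 1) (dM n x))"

definition filtered_homotopic ::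
  "(int \<Rightarrow> ('a, 'm) ring_scheme) \<Rightarrow> (int \<Rightarrow> 'a \<Rightarrow> 'a) \<Rightarrow> (nat \<Rightarrow> int \<Rightarrow> 'a set) \<Rightarrow>
   (int \<Rightarrow> ('b, 'n) ring_scheme) \<Rightarrow> (int \<Rightarrow> 'b \<Rightarrow> 'b) \<Rightarrow> (nat \<Rightarrow> int \<Rightarrow> 'b set) \<Rightarrow>
   (int \<Rightarrow> 'a \<Rightarrow> 'b) \<Rightarrow> (int \<Rightarrow> 'a \<Rightarrow> 'b) \<Rightarrow> bool"
  where "filtered_homotopic M dM FM N dN FN f g \<longleftrightarrow>
    (\<exists>h. graded_map M N 1 h \<and> preserves_filtration FM FN 1 h \<and>
      (\<forall>n. \<forall>x\<in>carrier (M n).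
        f n x \<ominus>\<^bsub>N n\<^esub> g n x = dN (n + 1) (h n x) \<oplus>\<^bsub>N n\<^esub> h (n - 1) (dM n x)))"

definition filtered_homotopy_inverse ::
  "(int \<Rightarrow> ('a, 'm) ring_scheme) \<Rightarrow> (int \<Rightarrow> 'a \<Rightarrow> 'a) \<Rightarrow> (nat \<Rightarrow> int \<Rightarrow> 'a set) \<Rightarrow>
   (int \<Rightarrow> ('b, 'n) ring_scheme) \<Rightarrow> (int \<Rightarrow> 'b \<Rightarrow> 'b) \<Rightarrow> (nat \<Rightarrow> int \<Rightarrow> 'b set) \<Rightarrow>
   (int \<Rightarrow> 'a \<Rightarrow> 'b) \<Rightarrow> (int \<Rightarrow> 'b \<Rightarrow> 'a) \<Rightarrow> bool"
  where "filtered_homotopy_inverse M dM FM N dN FN f g \<longleftrightarrow>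
    filtered_homotopic M dM FM M dM FM (\<lambda>n. g n \<circ> f n) (\<lambda>n. id) \<and>
    filtered_homotopic N dN FN N dN FN (\<lambda>n. f n \<circ> g n) (\<lambda>n. id)"

end

theory Submission
  imports Defs
begin

text \<open>
  Write \<open>GF = 1 + dH + Hd\<close> and \<open>d' = d + \<delta>\<close>. As \<open>H\<delta>\<close> raises the filtration, completeness gives
  \<open>S = (1 - H\<delta>)\<^sup>-\<^sup>1\<close> as a geometric series; put \<open>X = \<delta>S\<close>. The formulas of the classical
  perturbation lemma, \<open>e' = e + FXG\<close>, \<open>F' = F + FXH\<close>, \<open>G' = SG\<close> and \<open>H' = SH\<close>, make \<open>e'\<close> a
  differential, \<open>F'\<close> and \<open>G'\<close> chain maps and \<open>G'F' = 1 + d'H' + H'd'\<close> without any side conditions on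
  \<open>H\<close>; everything rests on \<open>d'S = S(d + GFX)\<close>.

  A homotopy \<open>L\<close> from \<open>FG\<close> to \<open>1\<close> is not perturbed by a formula of this kind. Instead,
  \<open>\<phi> = F'G'\<close> satisfies \<open>\<phi> \<simeq> 1 - r\<close> where \<open>r = 1 + e'L + Le' - \<phi>\<close> raises the filtration, so \<open>\<phi>\<close> is
  homotopic to an invertible chain map. Since \<open>G'F' \<simeq> 1\<close> also gives \<open>\<phi>\<phi> \<simeq> \<phi>\<close>, it follows that \<open>\<phi> \<simeq> 1\<close>.
\<close>

subsection \<open>Subtraction in abelian groups\<close>

lemma (in abelian_group) add_add_minus_cancel:
  "\<lbrakk>x \<in> carrier G; y \<in> carrier G\<rbrakk> \<Longrightarrow> x \<oplus> (y \<oplus> \<ominus> x) = y"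
  by (metis a_comm a_inv_closed r_neg2 a_lcomm)

lemma (in abelian_group) minus_add_cancel:
  "\<lbrakk>x \<in> carrier G; y \<in> carrier G\<rbrakk> \<Longrightarrow> (x \<ominus> y) \<oplus> y = x"
  by (simp add: a_minus_def a_assoc l_neg)

lemma (in abelian_group) minus_eq_zeroD:
  "\<lbrakk>x \<ominus> y = \<zero>; x \<in> carrier G; y \<in> carrier G\<rbrakk> \<Longrightarrow> x = y"
  by (metis minus_add_cancel l_zero)

lemma (in abelian_group) minus_minus_cancel:
  "\<lbrakk>x \<in> carrier G; y \<in> carrier G\<rbrakk> \<Longrightarrow> x \<ominus> (x \<ominus> y) = y"
  by (simp add: a_minus_def minus_add r_neg2)

lemma (in abelian_group) minus_add_eq_a_inv:
  "\<lbrakk>x \<in> carrier G; y \<in> carrier G\<rbrakk> \<Longrightarrow> x \<ominus> (x \<oplus> y) = \<ominus> y"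
  by (simp add: a_minus_def minus_add r_neg2)

lemma (in abelian_group) a_inv_minus:
  "\<lbrakk>x \<in> carrier G; y \<in> carrier G\<rbrakk> \<Longrightarrow> \<ominus> (x \<ominus> y) = y \<ominus> x"
  by (simp add: a_minus_def minus_add a_comm)

lemma (in abelian_group) minus_eq_iff:
  "\<lbrakk>x \<in> carrier G; y \<in> carrier G; z \<in> carrier G\<rbrakk> \<Longrightarrow> x \<ominus> y = z \<longleftrightarrow> x = y \<oplus> z"
  by (metis a_comm minus_add_cancel minus_closed add.right_cancel)

lemma (in abelian_group) add_minus_add_left:
  "\<lbrakk>x \<in> carrier G; y \<in> carrier G; z \<in> carrier G\<rbrakk> \<Longrightarrow> (z \<oplus> x) \<ominus> (z \<oplus> y) = x \<ominus> y"
  by (simp add: a_minus_def minus_add a_ac add_add_minus_cancel)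

lemma (in abelian_group) minus_minus_minus:
  "\<lbrakk>x \<in> carrier G; y \<in> carrier G; z \<in> carrier G; w \<in> carrier G\<rbrakk> \<Longrightarrow>
    (x \<ominus> (y \<oplus> z)) \<ominus> (w \<ominus> z) = x \<ominus> (y \<oplus> w)"
  using add_add_minus_cancel[of z "\<ominus> w \<oplus> \<ominus> y"]
  by (simp add: a_minus_def minus_add a_ac)

subsection \<open>Filtered graded groups and completeness\<close>

text \<open>The differential is left out because the given and the perturbed differential live on
  the same filtered groups.\<close>

locale filtered_graded_group =
  fixes M :: "int \<Rightarrow> ('a, 'm) ring_scheme" and F :: "nat \<Rightarrow> int \<Rightarrow> 'a set"
  assumes abelian: "abelian_group (M n)"
    and subgroup: "additive_subgroup (F p n) (M n)"
    and zeroth: "F 0 n = carrier (M n)"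
    and descending: "F (Suc p) n \<subseteq> F p n"
begin

sublocale group: abelian_group "M n" for n
  by (rule abelian)

sublocale step: additive_subgroup "F p n" "M n" for p n
  by (rule subgroup)

lemma antimono: "p \<le> q \<Longrightarrow> F q n \<subseteq> F p n"
  using descending by (rule lift_Suc_antimono_le)

lemma inv_mem: "x \<in> F p n \<Longrightarrow> \<ominus>\<^bsub>M n\<^esub> x \<in> F p n"
  using step.a_inv_closed by blast

lemma diff_mem: "x \<in> F p n \<Longrightarrow> y \<in> F p n \<Longrightarrow> x \<ominus>\<^bsub>M n\<^esub> y \<in> F p n"
  by (simp add: a_minus_def inv_mem)

lemma mem_carrier: "x \<in> F p n \<Longrightarrow> x \<in> carrier (M n)"
  using step.a_subset by blast

end

text \<open>The number \<open>s\<close> records by how much the filtration is raised: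
  \<open>s = 0\<close> for the filtration-preserving maps, \<open>s = 1\<close> for the difference
  between a map and its perturbation. Shifts add under composition, so one small factor makes a
  whole composite small.\<close>

locale filtered_map =
  dom: filtered_graded_group M FM + cod: filtered_graded_group N FN
  for M :: "int \<Rightarrow> ('a, 'm) ring_scheme" and FM
    and N :: "int \<Rightarrow> ('b, 'n) ring_scheme" and FN +
  fixes s :: nat and k :: int and f :: "int \<Rightarrow> 'a \<Rightarrow> 'b"
  assumes graded: "graded_map M N k f"
    and shift: "x \<in> FM p n \<Longrightarrow> f n x \<in> FN (p + s) (n + k)"
begin

sublocale hom: abelian_group_hom "M n" "N (n + k)" "f n" for n
  using graded by (simp add: graded_map_def)

text \<open>The target degree is a variable with its own equation, so that the rule also matches
  degrees written as \<open>n\<close> or \<open>n - 1\<close> and leaves integer arithmetic to the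
  simplifier.\<close>

lemma closed: "x \<in> carrier (M n) \<Longrightarrow> m = n + k \<Longrightarrow> f n x \<in> carrier (N m)"
  by simp

lemma add: "x \<in> carrier (M n) \<Longrightarrow> y \<in> carrier (M n) \<Longrightarrow>
    f n (x \<oplus>\<^bsub>M n\<^esub> y) = f n x \<oplus>\<^bsub>N (n + k)\<^esub> f n y"
  by simp

lemma zero: "f n \<zero>\<^bsub>M n\<^esub> = \<zero>\<^bsub>N (n + k)\<^esub>"
  by simp

lemma diff: "x \<in> carrier (M n) \<Longrightarrow> y \<in> carrier (M n) \<Longrightarrow>
    f n (x \<ominus>\<^bsub>M n\<^esub> y) = f n x \<ominus>\<^bsub>N (n + k)\<^esub> f n y"
  by (simp add: a_minus_def)

end

lemma (in filtered_complex) filtered_graded_group: "filtered_graded_group M F"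
  by (simp add: filtered_graded_group_def abelian filtration_subgroup filtration_0
      filtration_descending)

text \<open>Sequential form of completeness: \<open>separated\<close> comes from injectivity of the
  map to the inverse limit, \<open>Cauchy\<close> from its surjectivity.\<close>

locale complete_graded_group = filtered_graded_group +
  assumes separated: "\<lbrakk>\<And>p. x \<in> F p n\<rbrakk> \<Longrightarrow> x = \<zero>\<^bsub>M n\<^esub>"
    and Cauchy: "\<lbrakk>\<And>p. s p \<in> carrier (M n); \<And>p. s (Suc p) \<ominus>\<^bsub>M n\<^esub> s p \<in> F p n\<rbrakk>
      \<Longrightarrow> \<exists>x\<in>carrier (M n). \<forall>p. x \<ominus>\<^bsub>M n\<^esub> s p \<in> F p n"

lemma (in filtered_graded_group) coset_eq_iff:
  assumes "x \<in> carrier (M n)" "y \<in> carrier (M n)"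
  shows "F p n +>\<^bsub>M n\<^esub> x = F p n +>\<^bsub>M n\<^esub> y \<longleftrightarrow> x \<ominus>\<^bsub>M n\<^esub> y \<in> F p n"
proof -
  interpret sub: abelian_subgroup "F p n" "M n"
    by (rule abelian_subgroupI3[OF subgroup abelian])
  show ?thesis
  proof
    assume "F p n +>\<^bsub>M n\<^esub> x = F p n +>\<^bsub>M n\<^esub> y"
    then have "x \<in> F p n +>\<^bsub>M n\<^esub> y"
      using sub.a_rcos_self assms by metis
    then show "x \<ominus>\<^bsub>M n\<^esub> y \<in> F p n"
      using assms by (auto simp: a_r_coset_def' a_minus_def group.a_assoc group.r_neg)
  next
    assume "x \<ominus>\<^bsub>M n\<^esub> y \<in> F p n"
    moreover have "x = (x \<ominus>\<^bsub>M n\<^esub> y) \<oplus>\<^bsub>M n\<^esub> y"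
      using assms by (simp add: group.minus_add_cancel)
    ultimately have "x \<in> F p n +>\<^bsub>M n\<^esub> y"
      by (auto simp: a_r_coset_def')
    then show "F p n +>\<^bsub>M n\<^esub> x = F p n +>\<^bsub>M n\<^esub> y"
      using group.a_repr_independence[OF _ assms(2)] step.a_subgroup by metis
  qed
qed

lemma (in complete_filtered_complex) complete_graded_group: "complete_graded_group M F"
proof -
  interpret filtered_graded_group M F
    by (rule filtered_graded_group)
  let ?q = "\<lambda>n x p. F p n +>\<^bsub>M n\<^esub> x"
  have bij: "bij_betw (?q n) (carrier (M n)) (carrier (quotient_limit (M n) (\<lambda>p. F p n)))" for n
    using complete[of n] by (simp add: iso_def)
  show ?thesis
  proof
    fix x n assume x: "\<And>p. x \<in> F p n"
    then have "x \<in> carrier (M n)"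
      using mem_carrier by blast
    moreover have "?q n x = ?q n \<zero>\<^bsub>M n\<^esub>"
      using x \<open>x \<in> carrier (M n)\<close> by (simp add: fun_eq_iff coset_eq_iff a_minus_def)
    ultimately show "x = \<zero>\<^bsub>M n\<^esub>"
      using bij[of n] by (metis bij_betw_def inj_onD group.zero_closed)
  next
    fix s n
    assume s: "\<And>p::nat. s p \<in> carrier (M n)" and
      diff: "\<And>p. s (Suc p) \<ominus>\<^bsub>M n\<^esub> s p \<in> F p n"
    let ?X = "\<lambda>p. F p n +>\<^bsub>M n\<^esub> s p"
    \<comment> \<open>The cosets of the \<open>s p\<close> form a compatible family, since
      \<open>F p + F (Suc p) = F p\<close> and consecutive terms agree modulo \<open>F p\<close>. A
      preimage of this family is the limit.\<close>
    have "F p n <+>\<^bsub>M n\<^esub> ?X (Suc p) = ?X p" for p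
    proof -
      interpret sub: abelian_subgroup "F p n" "M n"
        by (rule abelian_subgroupI3[OF subgroup abelian])
      have "F p n <+>\<^bsub>M n\<^esub> ?X (Suc p) = (F p n <+>\<^bsub>M n\<^esub> F (Suc p) n) +>\<^bsub>M n\<^esub> s (Suc p)"
        by (rule group.a_setmult_rcos_assoc) (use s mem_carrier in auto)
      also have "F p n <+>\<^bsub>M n\<^esub> F (Suc p) n = F p n"
      proof
        show "F p n <+>\<^bsub>M n\<^esub> F (Suc p) n \<subseteq> F p n"
          using descending by (auto simp: set_add_def set_mult_def)
        show "F p n \<subseteq> F p n <+>\<^bsub>M n\<^esub> F (Suc p) n"
        proof
          fix x assume x: "x \<in> F p n"
          then have "x = x \<oplus>\<^bsub>M n\<^esub> \<zero>\<^bsub>M n\<^esub>"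
            using group.r_zero[OF mem_carrier] by metis
          with x show "x \<in> F p n <+>\<^bsub>M n\<^esub> F (Suc p) n"
            using step.zero_closed[of n "Suc p"] unfolding set_add_def' by blast
        qed
      qed
      also have "F p n +>\<^bsub>M n\<^esub> s (Suc p) = ?X p"
        using diff s by (simp add: coset_eq_iff)
      finally show ?thesis .
    qed
    moreover have "?X p \<in> carrier (M n A_Mod F p n)" for p
      unfolding A_FactGroup_def' using s mem_carrier by (auto intro!: group.a_rcosetsI)
    ultimately have "?X \<in> carrier (quotient_limit (M n) (\<lambda>p. F p n))"
      by (simp add: quotient_limit_def PiE_iff)
    then have "?X \<in> ?q n ` carrier (M n)"
      by (simp only: bij_betw_imp_surj_on[OF bij])
    then obtain x where x: "x \<in> carrier (M n)" "?X = ?q n x"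
      by blast
    have "x \<ominus>\<^bsub>M n\<^esub> s p \<in> F p n" for p
      using fun_cong[OF x(2), of p] coset_eq_iff[OF x(1) s] by metis
    with x(1) show "\<exists>x\<in>carrier (M n). \<forall>p. x \<ominus>\<^bsub>M n\<^esub> s p \<in> F p n"
      by blast
  qed
qed

subsection \<open>Filtration-shifting maps\<close>

lemma filtered_mapI:
  assumes "filtered_graded_group M FM" "filtered_graded_group N FN"
    and "\<And>n x. x \<in> carrier (M n) \<Longrightarrow> f n x \<in> carrier (N (n + k))"
    and "\<And>n x y. \<lbrakk>x \<in> carrier (M n); y \<in> carrier (M n)\<rbrakk> \<Longrightarrow>
      f n (x \<oplus>\<^bsub>M n\<^esub> y) = f n x \<oplus>\<^bsub>N (n + k)\<^esub> f n y"
    and "\<And>p n x. x \<in> FM p n \<Longrightarrow> f n x \<in> FN (p + s) (n + k)"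
  shows "filtered_map M FM N FN s k f"
proof -
  interpret M: filtered_graded_group M FM by fact
  interpret N: filtered_graded_group N FN by fact
  have "abelian_group_hom (M n) (N (n + k)) (f n)" for n
    by (rule abelian_group_homI[OF M.abelian N.abelian])
      (auto intro!: group_hom.intro group_hom_axioms.intro M.group.a_group N.group.a_group
        homI assms(3,4))
  then show ?thesis
    by unfold_locales (auto simp: graded_map_def assms(5))
qed

text \<open>The intermediate degree \<open>i n\<close>, the total shift and the total degree are
  variables tied by equations, so that the rule unifies with composites whose degrees are written in
  simplified form.\<close>

lemma filtered_map_comp:
  assumes "filtered_map M FM N FN s k f" "filtered_map N FN P FP t l g"
    and "u = s + t" "m = k + l" "\<And>n. i n = n + k"
  shows "filtered_map M FM P FP u m (\<lambda>n x. g (i n) (f n x))"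
proof -
  interpret f: filtered_map M FM N FN s k f by fact
  interpret g: filtered_map N FN P FP t l g by fact
  show ?thesis
  proof (rule filtered_mapI)
    fix p n x assume "x \<in> FM p n"
    from g.shift[OF f.shift[OF this]] show "g (i n) (f n x) \<in> FP (p + u) (n + m)"
      by (simp add: assms(3-5) add.assoc)
  next
    fix n x assume x: "x \<in> carrier (M n)"
    show "g (i n) (f n x) \<in> carrier (P (n + m))"
      using g.closed[OF f.closed[OF x refl] refl] by (simp add: assms(4,5) add.assoc)
    fix y assume y: "y \<in> carrier (M n)"
    show "g (i n) (f n (x \<oplus>\<^bsub>M n\<^esub> y)) = g (i n) (f n x) \<oplus>\<^bsub>P (n + m)\<^esub> g (i n) (f n y)"
      using x y by (simp add: assms(4,5) flip: add.assoc)
  qed (rule f.dom.filtered_graded_group_axioms g.cod.filtered_graded_group_axioms)+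
qed

lemma filtered_map_add:
  assumes "filtered_map M FM N FN s k f" "filtered_map M FM N FN s k g" "\<And>n. i n = n + k"
  shows "filtered_map M FM N FN s k (\<lambda>n x. f n x \<oplus>\<^bsub>N (i n)\<^esub> g n x)"
proof -
  interpret f: filtered_map M FM N FN s k f by fact
  interpret g: filtered_map M FM N FN s k g by fact
  show ?thesis
    by (rule filtered_mapI, rule f.dom.filtered_graded_group_axioms,
        rule f.cod.filtered_graded_group_axioms)
      (auto simp: assms(3) f.cod.group.a_ac f.shift g.shift intro!: f.cod.step.a_closed)
qed

lemma filtered_map_diff:
  assumes "filtered_map M FM N FN s k f" "filtered_map M FM N FN s k g" "\<And>n. i n = n + k"
  shows "filtered_map M FM N FN s k (\<lambda>n x. f n x \<ominus>\<^bsub>N (i n)\<^esub> g n x)"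
proof -
  interpret f: filtered_map M FM N FN s k f by fact
  interpret g: filtered_map M FM N FN s k g by fact
  show ?thesis
    by (rule filtered_mapI, rule f.dom.filtered_graded_group_axioms,
        rule f.cod.filtered_graded_group_axioms)
      (auto simp: assms(3) a_minus_def f.cod.group.a_ac f.cod.group.minus_add f.shift g.shift
        intro!: f.cod.step.a_closed f.cod.inv_mem)
qed

lemma filtered_map_weaken:
  assumes "filtered_map M FM N FN s k f" "t \<le> s"
  shows "filtered_map M FM N FN t k f"
proof -
  interpret f: filtered_map M FM N FN s k f by fact
  show ?thesis
    using f.shift f.cod.antimono \<open>t \<le> s\<close>
    by (intro filtered_map.intro filtered_map_axioms.intro f.dom.filtered_graded_group_axioms
        f.cod.filtered_graded_group_axioms f.graded) (meson add_le_cancel_left subsetD)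
qed

lemma filtered_map_iff:
  assumes "filtered_graded_group M FM" "filtered_graded_group N FN"
  shows "filtered_map M FM N FN 0 k f \<longleftrightarrow> graded_map M N k f \<and> preserves_filtration FM FN k f"
  using assms
  by (auto simp: filtered_map_def filtered_map_axioms_def preserves_filtration_def image_subset_iff)

section \<open>Perturbations and homotopies in terms of filtration-shifting maps\<close>

lemma is_perturbationI:
  assumes "filtered_map M FM N FN 0 k f" "filtered_map M FM N FN 1 k \<epsilon>" "filtered_map M FM N FN 0 k g"
    and g: "\<And>n x. x \<in> carrier (M n) \<Longrightarrow> g n x = f n x \<oplus>\<^bsub>N (n + k)\<^esub> \<epsilon> n x"
  shows "is_perturbation M FM N FN k f g"
proof -
  interpret f: filtered_map M FM N FN 0 k f by fact
  interpret \<epsilon>: filtered_map M FM N FN 1 k \<epsilon> by fact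
  interpret g: filtered_map M FM N FN 0 k g by fact
  have "f n x \<ominus>\<^bsub>N (n + k)\<^esub> g n x \<in> FN (Suc p) (n + k)" if "x \<in> FM p n" for p n x
    using \<epsilon>.shift[OF that] f.dom.mem_carrier[OF that]
    by (simp add: g f.cod.group.minus_add_eq_a_inv f.cod.inv_mem)
  then show ?thesis
    by (simp add: is_perturbation_def g.graded)
qed

text \<open>Preservation of the filtration by \<open>g\<close> is derived from
  \<open>g = f - (f - g)\<close>: the bracket maps \<open>FM p\<close> into
  \<open>FN (Suc p)\<close>, which lies in \<open>FN p\<close>.\<close>

lemma is_perturbationD:
  assumes "filtered_map M FM N FN 0 k f" and pert: "is_perturbation M FM N FN k f g"
  shows "filtered_map M FM N FN 0 k g"
    and "filtered_map M FM N FN 1 k (\<lambda>n x. g n x \<ominus>\<^bsub>N (n + k)\<^esub> f n x)"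
proof -
  interpret f: filtered_map M FM N FN 0 k f by fact
  interpret g: abelian_group_hom "M n" "N (n + k)" "g n" for n
    using pert by (simp add: is_perturbation_def graded_map_def)
  have diff: "f n x \<ominus>\<^bsub>N (n + k)\<^esub> g n x \<in> FN (Suc p) (n + k)" if "x \<in> FM p n" for p n x
    using pert that by (simp add: is_perturbation_def)
  show g: "filtered_map M FM N FN 0 k g"
  proof (rule filtered_mapI)
    fix p n x assume x: "x \<in> FM p n"
    then have "f n x \<ominus>\<^bsub>N (n + k)\<^esub> (f n x \<ominus>\<^bsub>N (n + k)\<^esub> g n x) \<in> FN p (n + k)"
      using f.shift[OF x] diff[OF x] f.cod.descending[of p "n + k"]
      by (auto intro: f.cod.diff_mem[OF _ subsetD])
    then show "g n x \<in> FN (p + 0) (n + k)"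
      using f.dom.mem_carrier[OF x] by (simp add: f.cod.group.minus_minus_cancel)
  qed (simp_all add: f.dom.filtered_graded_group_axioms f.cod.filtered_graded_group_axioms)
  interpret diff: filtered_map M FM N FN 0 k "\<lambda>n x. g n x \<ominus>\<^bsub>N (n + k)\<^esub> f n x"
    by (rule filtered_map_diff[OF g assms(1) refl])
  show "filtered_map M FM N FN 1 k (\<lambda>n x. g n x \<ominus>\<^bsub>N (n + k)\<^esub> f n x)"
  proof (intro filtered_map.intro filtered_map_axioms.intro diff.graded
      f.dom.filtered_graded_group_axioms f.cod.filtered_graded_group_axioms)
    fix p n x assume x: "x \<in> FM p n"
    show "g n x \<ominus>\<^bsub>N (n + k)\<^esub> f n x \<in> FN (p + 1) (n + k)"
      using f.cod.inv_mem[OF diff[OF x]] f.dom.mem_carrier[OF x]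
      by (simp add: f.cod.group.a_inv_minus)
  qed
qed

text \<open>Brings the homotopy relation into the subtraction-free form in which the perturbation
  formulas are computed.\<close>

lemma filtered_homotopic_iff:
  assumes "filtered_graded_group M FM" "filtered_graded_group N FN"
    and "filtered_map M FM M FM 0 (-1) dM" "filtered_map N FN N FN 0 (-1) dN"
    and "filtered_map M FM N FN 0 0 f" "filtered_map M FM N FN 0 0 g"
  shows "filtered_homotopic M dM FM N dN FN f g \<longleftrightarrow>
    (\<exists>h. filtered_map M FM N FN 0 1 h \<and> (\<forall>n. \<forall>x\<in>carrier (M n).
      f n x = g n x \<oplus>\<^bsub>N n\<^esub> (dN (n + 1) (h n x) \<oplus>\<^bsub>N n\<^esub> h (n - 1) (dM n x))))"
proof -
  interpret dM: filtered_map M FM M FM 0 "-1" dM by fact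
  interpret dN: filtered_map N FN N FN 0 "-1" dN by fact
  interpret f: filtered_map M FM N FN 0 0 f by fact
  interpret g: filtered_map M FM N FN 0 0 g by fact
  have "(f n x \<ominus>\<^bsub>N n\<^esub> g n x = dN (n + 1) (h n x) \<oplus>\<^bsub>N n\<^esub> h (n - 1) (dM n x)) \<longleftrightarrow>
      (f n x = g n x \<oplus>\<^bsub>N n\<^esub> (dN (n + 1) (h n x) \<oplus>\<^bsub>N n\<^esub> h (n - 1) (dM n x)))"
    if "filtered_map M FM N FN 0 1 h" "x \<in> carrier (M n)" for h n x
  proof -
    interpret h: filtered_map M FM N FN 0 1 h by fact
    show ?thesis
      using that(2) by (intro dN.dom.group.minus_eq_iff)
        (simp_all add: f.closed g.closed dN.closed h.closed dM.closed)
  qed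
  then show ?thesis
    unfolding filtered_homotopic_def filtered_map_iff[OF assms(1,2), of 1, symmetric]
    by (metis (no_types, lifting) filtered_map_iff[OF assms(1,2)])
qed

subsection \<open>Inverting maps close to the identity\<close>

text \<open>Here \<open>S\<close> is \<open>(1 - r)^-1\<close>. Its value at \<open>y\<close> is the
  unique solution of \<open>x = y + r x\<close>; existence is the convergence of the partial sums,
  and uniqueness yields both additivity and the identity \<open>S = 1 + S r\<close>.\<close>

lemma (in complete_graded_group) geometric_series:
  assumes "filtered_map M F M F 1 0 r"
  shows "\<exists>S. filtered_map M F M F 0 0 S \<and> (\<forall>n. \<forall>x\<in>carrier (M n).
    S n x = x \<oplus>\<^bsub>M n\<^esub> r n (S n x) \<and> S n x = x \<oplus>\<^bsub>M n\<^esub> S n (r n x))"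
proof -
  interpret r: filtered_map M F M F 1 0 r by fact
  have r_closed[simp]: "r n x \<in> carrier (M n)" if "x \<in> carrier (M n)" for n x
    using r.closed[OF that] by simp
  have r_add: "r n (x \<oplus>\<^bsub>M n\<^esub> y) = r n x \<oplus>\<^bsub>M n\<^esub> r n y"
    if "x \<in> carrier (M n)" "y \<in> carrier (M n)" for n x y
    using r.add[OF that] by simp
  have r_diff: "r n (x \<ominus>\<^bsub>M n\<^esub> y) = r n x \<ominus>\<^bsub>M n\<^esub> r n y"
    if "x \<in> carrier (M n)" "y \<in> carrier (M n)" for n x y
    using r.diff[OF that] by simp
  have r_shift: "r n x \<in> F (Suc p) n" if "x \<in> F p n" for n x p
    using r.shift[OF that] by simp
  \<comment> \<open>Each application of \<open>r\<close> moves a fixed point one filtration step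
    deeper, so it lies in all of them.\<close>
  have fixpoint_0: "x = \<zero>\<^bsub>M n\<^esub>" if x: "x \<in> carrier (M n)" "x = r n x" for n x
  proof (rule separated)
    show "x \<in> F p n" for p
    proof (induction p)
      case 0
      then show ?case using x by (simp add: zeroth)
    next
      case (Suc p)
      then show ?case using r_shift x(2) by metis
    qed
  qed
  have unique: "x = x'" if x: "x \<in> carrier (M n)" "x = y \<oplus>\<^bsub>M n\<^esub> r n x"
    and x': "x' \<in> carrier (M n)" "x' = y \<oplus>\<^bsub>M n\<^esub> r n x'" and y: "y \<in> carrier (M n)" for n x x' y
  proof -
    have "x \<ominus>\<^bsub>M n\<^esub> x' = r n x \<ominus>\<^bsub>M n\<^esub> r n x'"
      using x x' y group.add_minus_add_left[of "r n x" n "r n x'" y] by simp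
    then have "x \<ominus>\<^bsub>M n\<^esub> x' = \<zero>\<^bsub>M n\<^esub>"
      using x x' by (intro fixpoint_0) (simp_all flip: r_diff)
    then show ?thesis
      using x x' group.minus_eq_zeroD by blast
  qed
  have solution: "\<exists>x\<in>carrier (M n). x = y \<oplus>\<^bsub>M n\<^esub> r n x \<and> (\<forall>p. y \<in> F p n \<longrightarrow> x \<in> F p n)"
    if y: "y \<in> carrier (M n)" for n y
  proof -
    \<comment> \<open>The partial sums of \<open>y + r y + r (r y) + ...\<close>. Starting with the
      empty sum makes \<open>s (Suc p) - s p\<close> the \<open>p\<close>-th iterate of
      \<open>r\<close> on \<open>y\<close>, which lies in \<open>F p\<close>.\<close>
    define s where "s = rec_nat \<zero>\<^bsub>M n\<^esub> (\<lambda>_ x. y \<oplus>\<^bsub>M n\<^esub> r n x)"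
    have s_0: "s 0 = \<zero>\<^bsub>M n\<^esub>" and s_Suc: "s (Suc p) = y \<oplus>\<^bsub>M n\<^esub> r n (s p)" for p
      by (simp_all add: s_def)
    have s_closed[simp]: "s p \<in> carrier (M n)" for p
      by (induction p) (simp_all add: s_0 s_Suc y)
    have s_diff: "s (Suc p) \<ominus>\<^bsub>M n\<^esub> s p \<in> F p n" for p
    proof (induction p)
      case 0
      then show ?case by (simp add: zeroth)
    next
      case (Suc p)
      have "s (Suc (Suc p)) \<ominus>\<^bsub>M n\<^esub> s (Suc p) = r n (s (Suc p) \<ominus>\<^bsub>M n\<^esub> s p)"
        using y by (simp add: s_Suc[of "Suc p"] s_Suc[of p] r_diff group.add_minus_add_left)
      then show ?case
        using r_shift[OF Suc] by simp
    qed
    obtain x where x: "x \<in> carrier (M n)" and lim: "\<And>p. x \<ominus>\<^bsub>M n\<^esub> s p \<in> F p n"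
      using Cauchy[of s n] s_closed s_diff by blast
    have "x \<ominus>\<^bsub>M n\<^esub> (y \<oplus>\<^bsub>M n\<^esub> r n x) = \<zero>\<^bsub>M n\<^esub>"
    proof (rule separated)
      \<comment> \<open>The error of \<open>x\<close> as a solution is
        \<open>(x - s (Suc p)) - r (x - s p)\<close>, and both terms lie in
        \<open>F (Suc p)\<close>.\<close>
      fix p
      have "x \<ominus>\<^bsub>M n\<^esub> (y \<oplus>\<^bsub>M n\<^esub> r n x) =
          (x \<ominus>\<^bsub>M n\<^esub> s (Suc p)) \<ominus>\<^bsub>M n\<^esub> r n (x \<ominus>\<^bsub>M n\<^esub> s p)"
        using x y by (simp add: s_Suc r_diff group.minus_minus_minus)
      moreover have "r n (x \<ominus>\<^bsub>M n\<^esub> s p) \<in> F (Suc p) n"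
        using lim r_shift by blast
      ultimately have "x \<ominus>\<^bsub>M n\<^esub> (y \<oplus>\<^bsub>M n\<^esub> r n x) \<in> F (Suc p) n"
        using lim[of "Suc p"] diff_mem by simp
      then show "x \<ominus>\<^bsub>M n\<^esub> (y \<oplus>\<^bsub>M n\<^esub> r n x) \<in> F p n"
        using descending by blast
    qed
    then have "x = y \<oplus>\<^bsub>M n\<^esub> r n x"
      using x y group.minus_eq_zeroD by simp
    \<comment> \<open>If \<open>y\<close> lies in \<open>F p\<close>, so do all partial sums, and
      \<open>x\<close> differs from \<open>s p\<close> by an element of \<open>F p\<close>. This
      makes \<open>S\<close> filtration-preserving.\<close>
    moreover have "x \<in> F p n" if "y \<in> F p n" for p
    proof -
      have "s q \<in> F p n" for q
      proof (induction q)
        case 0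
        then show ?case by (simp add: s_0)
      next
        case (Suc q)
        then have "r n (s q) \<in> F p n"
          using r_shift descending by blast
        with that show ?case by (simp add: s_Suc)
      qed
      then have "(x \<ominus>\<^bsub>M n\<^esub> s p) \<oplus>\<^bsub>M n\<^esub> s p \<in> F p n"
        using lim by simp
      then show ?thesis
        using x by (simp add: group.minus_add_cancel)
    qed
    ultimately show ?thesis
      using x by blast
  qed
  define S where "S n y = (SOME x. x \<in> carrier (M n) \<and> x = y \<oplus>\<^bsub>M n\<^esub> r n x \<and>
      (\<forall>p. y \<in> F p n \<longrightarrow> x \<in> F p n))" for n y
  have S: "S n y \<in> carrier (M n) \<and> S n y = y \<oplus>\<^bsub>M n\<^esub> r n (S n y) \<and>
      (\<forall>p. y \<in> F p n \<longrightarrow> S n y \<in> F p n)" if "y \<in> carrier (M n)" for n y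
    unfolding S_def by (rule someI_ex) (use solution[OF that] in blast)
  have S_closed[simp]: "S n x \<in> carrier (M n)" if "x \<in> carrier (M n)" for n x
    using S that by blast
  have "S n (x \<oplus>\<^bsub>M n\<^esub> y) = S n x \<oplus>\<^bsub>M n\<^esub> S n y"
    if x: "x \<in> carrier (M n)" and y: "y \<in> carrier (M n)" for n x y
  proof (rule unique)
    have "S n x \<oplus>\<^bsub>M n\<^esub> S n y = (x \<oplus>\<^bsub>M n\<^esub> r n (S n x)) \<oplus>\<^bsub>M n\<^esub> (y \<oplus>\<^bsub>M n\<^esub> r n (S n y))"
      using S x y by metis
    also have "\<dots> = (x \<oplus>\<^bsub>M n\<^esub> y) \<oplus>\<^bsub>M n\<^esub> r n (S n x \<oplus>\<^bsub>M n\<^esub> S n y)"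
      using x y by (simp add: r_add group.a_ac)
    finally show "S n x \<oplus>\<^bsub>M n\<^esub> S n y = (x \<oplus>\<^bsub>M n\<^esub> y) \<oplus>\<^bsub>M n\<^esub> r n (S n x \<oplus>\<^bsub>M n\<^esub> S n y)" .
  qed (use S x y in auto)
  then have map: "filtered_map M F M F 0 0 S"
    using S mem_carrier by (intro filtered_mapI filtered_graded_group_axioms) auto
  \<comment> \<open>The right-hand side solves the equation defining \<open>S n x\<close>, because
    \<open>r x + r (S (r x))\<close> is \<open>S (r x)\<close>.\<close>
  have "S n x = x \<oplus>\<^bsub>M n\<^esub> S n (r n x)" if x: "x \<in> carrier (M n)" for n x
  proof (rule unique)
    have "r n (x \<oplus>\<^bsub>M n\<^esub> S n (r n x)) = r n x \<oplus>\<^bsub>M n\<^esub> r n (S n (r n x))"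
      using S x by (simp add: r_add)
    also have "\<dots> = S n (r n x)"
      using S[OF r_closed[OF x]] by simp
    finally show "x \<oplus>\<^bsub>M n\<^esub> S n (r n x) = x \<oplus>\<^bsub>M n\<^esub> r n (x \<oplus>\<^bsub>M n\<^esub> S n (r n x))"
      by simp
  qed (use S x in auto)
  with S map show ?thesis
    by blast
qed

subsection \<open>The perturbation formulas\<close>

text \<open>
  The hypotheses are stated without subtraction, so that every identity derived from them reduces
  to associativity, commutativity and cancellation.
\<close>

locale homotopy_perturbation =
  d: filtered_map M FM M FM 0 "-1" d + \<delta>: filtered_map M FM M FM 1 "-1" \<delta> +
  e: filtered_map N FN N FN 0 "-1" e +
  F: filtered_map M FM N FN 0 0 F + G: filtered_map N FN M FM 0 0 G +
  H: filtered_map M FM M FM 0 1 H + S: filtered_map M FM M FM 0 0 S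
  for M :: "int \<Rightarrow> ('a, 'm) ring_scheme" and FM
    and N :: "int \<Rightarrow> ('b, 'n) ring_scheme" and FN
    and d \<delta> e F G H S +
  assumes e_e: "y \<in> carrier (N n) \<Longrightarrow> e (n - 1) (e n y) = \<zero>\<^bsub>N (n - 2)\<^esub>"
    and Maurer_Cartan: "x \<in> carrier (M n) \<Longrightarrow>
      d (n - 1) (\<delta> n x) \<oplus>\<^bsub>M (n - 2)\<^esub> \<delta> (n - 1) (d n x \<oplus>\<^bsub>M (n - 1)\<^esub> \<delta> n x) = \<zero>\<^bsub>M (n - 2)\<^esub>"
    and e_F: "x \<in> carrier (M n) \<Longrightarrow> e n (F n x) = F (n - 1) (d n x)"
    and d_G: "y \<in> carrier (N n) \<Longrightarrow> d n (G n y) = G (n - 1) (e n y)"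
    and G_F: "x \<in> carrier (M n) \<Longrightarrow>
      G n (F n x) = x \<oplus>\<^bsub>M n\<^esub> (d (n + 1) (H n x) \<oplus>\<^bsub>M n\<^esub> H (n - 1) (d n x))"
    and S_left: "x \<in> carrier (M n) \<Longrightarrow> S n x = x \<oplus>\<^bsub>M n\<^esub> H (n - 1) (\<delta> n (S n x))"
    and S_right: "x \<in> carrier (M n) \<Longrightarrow> S n x = x \<oplus>\<^bsub>M n\<^esub> S n (H (n - 1) (\<delta> n x))"
begin

lemmas closed [simp] = d.closed \<delta>.closed e.closed F.closed G.closed H.closed S.closed

text \<open>The factor \<open>\<delta>\<close> supplies the shift of one that makes
  \<open>e'\<close> a perturbation of \<open>e\<close>; the corrections of \<open>F\<close> and
  \<open>G\<close> are small for the same reason.\<close>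

lemma e_correction_map: "filtered_map N FN N FN 1 (-1) (\<lambda>n y. F (n - 1) (\<delta> n (S n (G n y))))"
  by (rule filtered_map_comp[OF filtered_map_comp[OF filtered_map_comp[OF
        G.filtered_map_axioms S.filtered_map_axioms] \<delta>.filtered_map_axioms] F.filtered_map_axioms])
    simp_all

lemma F_correction_map:
  "filtered_map M FM N FN 1 0 (\<lambda>n x. F n (\<delta> (n + 1) (S (n + 1) (H n x))))"
  by (rule filtered_map_comp[OF filtered_map_comp[OF filtered_map_comp[OF
        H.filtered_map_axioms S.filtered_map_axioms] \<delta>.filtered_map_axioms] F.filtered_map_axioms])
    simp_all

lemma G_correction_map: "filtered_map N FN M FM 1 0 (\<lambda>n y. H (n - 1) (\<delta> n (S n (G n y))))"
  by (rule filtered_map_comp[OF filtered_map_comp[OF filtered_map_comp[OF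
        G.filtered_map_axioms S.filtered_map_axioms] \<delta>.filtered_map_axioms] H.filtered_map_axioms])
    simp_all

lemmas M_ac = d.dom.group.a_ac and N_ac = e.dom.group.a_ac

definition d' where "d' n x = d n x \<oplus>\<^bsub>M (n - 1)\<^esub> \<delta> n x"
definition e' where "e' n y = e n y \<oplus>\<^bsub>N (n - 1)\<^esub> F (n - 1) (\<delta> n (S n (G n y)))"
definition F' where "F' n x = F n x \<oplus>\<^bsub>N n\<^esub> F n (\<delta> (n + 1) (S (n + 1) (H n x)))"
definition G' where "G' n y = S n (G n y)"
definition H' where "H' n x = S (n + 1) (H n x)"

sublocale e': filtered_map N FN N FN 0 "-1" e'
  unfolding e'_def
  by (intro filtered_map_add e.filtered_map_axioms filtered_map_weaken[OF e_correction_map]) simp_all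

sublocale F': filtered_map M FM N FN 0 0 F'
  unfolding F'_def
  by (intro filtered_map_add F.filtered_map_axioms filtered_map_weaken[OF F_correction_map]) simp_all

sublocale G': filtered_map N FN M FM 0 0 G'
  unfolding G'_def
  by (rule filtered_map_comp[OF G.filtered_map_axioms S.filtered_map_axioms]) simp_all

sublocale H': filtered_map M FM M FM 0 1 H'
  unfolding H'_def
  by (rule filtered_map_comp[OF H.filtered_map_axioms S.filtered_map_axioms]) simp_all

lemmas closed' [simp] = e'.closed F'.closed G'.closed H'.closed

lemma d'_closed [simp]: "x \<in> carrier (M n) \<Longrightarrow> m = n - 1 \<Longrightarrow> d' n x \<in> carrier (M m)"
  by (simp add: d'_def)

text \<open>One expansion of \<open>S\<close> exhibits \<open>G'\<close> as \<open>G\<close> plus a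
  term of shift one.\<close>

lemma G'_eq: "y \<in> carrier (N n) \<Longrightarrow> G' n y = G n y \<oplus>\<^bsub>M n\<^esub> H (n - 1) (\<delta> n (S n (G n y)))"
  unfolding G'_def by (rule S_left) simp

lemma perturbations:
  "is_perturbation N FN N FN (-1) e e'"
  "is_perturbation M FM N FN 0 F F'"
  "is_perturbation N FN M FM 0 G G'"
proof -
  show "is_perturbation N FN N FN (-1) e e'"
    by (rule is_perturbationI[OF e.filtered_map_axioms e_correction_map e'.filtered_map_axioms])
      (simp add: e'_def)
  show "is_perturbation M FM N FN 0 F F'"
    by (rule is_perturbationI[OF F.filtered_map_axioms F_correction_map F'.filtered_map_axioms])
      (simp add: F'_def)
  show "is_perturbation N FN M FM 0 G G'"
    by (rule is_perturbationI[OF G.filtered_map_axioms G_correction_map G'.filtered_map_axioms])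
      (simp add: G'_eq)
qed

text \<open>Put \<open>y = S z\<close> and \<open>w = d' y\<close>. By \<open>S_left\<close> and
  \<open>G_F\<close>, the terms \<open>d H \<delta> y\<close> match up and the argument of the outer
  \<open>S\<close> becomes \<open>w + H d \<delta> y\<close>. The Maurer-Cartan equation turns
  \<open>d \<delta> y\<close> into \<open>- \<delta> w\<close>, leaving
  \<open>w - H \<delta> w\<close>, which \<open>S\<close> maps to \<open>w\<close>.\<close>

lemma d'_S:
  assumes z: "z \<in> carrier (M n)"
  shows "d' n (S n z) =
    S (n - 1) (d n z \<oplus>\<^bsub>M (n - 1)\<^esub> G (n - 1) (F (n - 1) (\<delta> n (S n z))))"
proof -
  define y where "y = S n z"
  define w where "w = d n y \<oplus>\<^bsub>M (n - 1)\<^esub> \<delta> n y"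
  have y[simp]: "y \<in> carrier (M n)" and w[simp]: "w \<in> carrier (M (n - 1))"
    using z by (simp_all add: y_def w_def)
  have "d n y = d n (z \<oplus>\<^bsub>M n\<^esub> H (n - 1) (\<delta> n y))"
    using S_left[OF z] by (simp add: y_def)
  then have dy: "d n y = d n z \<oplus>\<^bsub>M (n - 1)\<^esub> d n (H (n - 1) (\<delta> n y))"
    using z by simp
  have "d n z \<oplus>\<^bsub>M (n - 1)\<^esub> G (n - 1) (F (n - 1) (\<delta> n y)) =
      w \<oplus>\<^bsub>M (n - 1)\<^esub> H (n - 2) (d (n - 1) (\<delta> n y))"
    using z G_F[of "\<delta> n y" "n - 1"] by (simp add: w_def dy M_ac)
  then have "S (n - 1) (d n z \<oplus>\<^bsub>M (n - 1)\<^esub> G (n - 1) (F (n - 1) (\<delta> n y))) =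
      S (n - 1) w \<oplus>\<^bsub>M (n - 1)\<^esub> S (n - 1) (H (n - 2) (d (n - 1) (\<delta> n y)))"
    by simp
  \<comment> \<open>Expanding \<open>S w\<close> as \<open>w + S H \<delta> w\<close> brings
    \<open>d \<delta> y\<close> and \<open>\<delta> w\<close> together under \<open>S H\<close>,
    where their sum vanishes.\<close>
  also have "\<dots> = w \<oplus>\<^bsub>M (n - 1)\<^esub>
      S (n - 1) (H (n - 2) (d (n - 1) (\<delta> n y) \<oplus>\<^bsub>M (n - 2)\<^esub> \<delta> (n - 1) w))"
    using S_right[OF w] by (simp add: M_ac)
  also have "\<dots> = w"
    using Maurer_Cartan[OF y] H.zero[of "n - 2"] S.zero[of "n - 1"] by (simp flip: w_def)
  finally show ?thesis
    by (simp add: d'_def w_def y_def)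
qed

text \<open>With \<open>X = \<delta> S\<close> this reads \<open>d X + X d + X G F X = 0\<close>. It
  is the Maurer-Cartan equation at \<open>S z\<close> after rewriting \<open>d' S z\<close> by
  \<open>d'_S\<close>.\<close>

lemma perturbed_Maurer_Cartan:
  assumes z: "z \<in> carrier (M n)"
  shows "d (n - 1) (\<delta> n (S n z)) \<oplus>\<^bsub>M (n - 2)\<^esub> \<delta> (n - 1) (S (n - 1)
      (d n z \<oplus>\<^bsub>M (n - 1)\<^esub> G (n - 1) (F (n - 1) (\<delta> n (S n z))))) = \<zero>\<^bsub>M (n - 2)\<^esub>"
  using Maurer_Cartan[of "S n z" n] S.closed[OF z] d'_S[OF z] by (simp only: d'_def add_0_right)

text \<open>Since \<open>F\<close> and \<open>G\<close> are chain maps and \<open>e e = 0\<close>,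
  the square of \<open>e + F X G\<close> is \<open>F (d X + X d + X G F X) G\<close>.\<close>

lemma e'_e':
  assumes y[simp]: "y \<in> carrier (N n)"
  shows "e' (n - 1) (e' n y) = \<zero>\<^bsub>N (n - 2)\<^esub>"
proof -
  define z where "z = G n y"
  have z[simp]: "z \<in> carrier (M n)" by (simp add: z_def)
  have "e' (n - 1) (e' n y) = F (n - 2) (d (n - 1) (\<delta> n (S n z)) \<oplus>\<^bsub>M (n - 2)\<^esub>
      \<delta> (n - 1) (S (n - 1) (d n z \<oplus>\<^bsub>M (n - 1)\<^esub> G (n - 1) (F (n - 1) (\<delta> n (S n z))))))"
    by (simp add: e'_def e_e e_F d_G flip: z_def) (simp add: z_def d_G)
  then show ?thesis
    using F.hom.hom_zero[of "n - 2"] perturbed_Maurer_Cartan[OF z] by (metis add_0_right)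
qed

text \<open>By \<open>d'_S\<close>,
  \<open>d' S G = S (d + G F X) G = S G (e + F X G)\<close>.\<close>

lemma d'_G':
  assumes "y \<in> carrier (N n)"
  shows "d' n (G' n y) = G' (n - 1) (e' n y)"
  using assms by (simp add: G'_def e'_def d'_S d_G)

text \<open>Expanding \<open>(e + F X G) (F + F X H)\<close> and inserting
  \<open>G F = 1 + d H + H d\<close> gives \<open>F\<close> applied to \<open>d + X + X H d\<close>
  plus \<open>(d X + X d + X G F X) H\<close>. The latter vanishes, and
  \<open>X = \<delta> + X H \<delta>\<close> turns the rest into
  \<open>(F + F X H) (d + \<delta>)\<close>.\<close>

lemma e'_F':
  assumes x[simp]: "x \<in> carrier (M n)"
  shows "e' n (F' n x) = F' (n - 1) (d' n x)"
proof -
  define X where "X n z = \<delta> n (S n z)" for n z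
  have X[simp]: "X n z \<in> carrier (M m)" if "z \<in> carrier (M n)" "m = n - 1" for n m z
    using that by (simp add: X_def)
  have X_add: "X n (u \<oplus>\<^bsub>M n\<^esub> v) = X n u \<oplus>\<^bsub>M (n - 1)\<^esub> X n v"
    if "u \<in> carrier (M n)" "v \<in> carrier (M n)" for n u v
    using that by (simp add: X_def)
  define h where "h = X (n + 1) (H n x)"
  have h[simp]: "h \<in> carrier (M n)"
    by (simp add: h_def)
  have MC: "d n h \<oplus>\<^bsub>M (n - 1)\<^esub> (X n (d (n + 1) (H n x)) \<oplus>\<^bsub>M (n - 1)\<^esub> X n (G n (F n h))) = \<zero>\<^bsub>M (n - 1)\<^esub>"
    using perturbed_Maurer_Cartan[of "H n x" "n + 1"] by (simp add: h_def X_def)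
  have X_G_F: "X n (G n (F n x)) = X n x \<oplus>\<^bsub>M (n - 1)\<^esub>
     (X n (d (n + 1) (H n x)) \<oplus>\<^bsub>M (n - 1)\<^esub> X n (H (n - 1) (d n x)))"
    by (simp add: G_F X_add)
  have X_eq: "X n x = \<delta> n x \<oplus>\<^bsub>M (n - 1)\<^esub> X n (H (n - 1) (\<delta> n x))"
    unfolding X_def by (subst S_right) simp_all
  have "e' n (F' n x) = F (n - 1) (d n x \<oplus>\<^bsub>M (n - 1)\<^esub> (d n h \<oplus>\<^bsub>M (n - 1)\<^esub>
     (X n (G n (F n x)) \<oplus>\<^bsub>M (n - 1)\<^esub> X n (G n (F n h)))))"
    by (simp add: e'_def F'_def e_F X_add N_ac flip: X_def h_def)
  also have "\<dots> = F (n - 1) ((d n x \<oplus>\<^bsub>M (n - 1)\<^esub> (X n x \<oplus>\<^bsub>M (n - 1)\<^esub> X n (H (n - 1) (d n x)))) \<oplus>\<^bsub>M (n - 1)\<^esub>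
     (d n h \<oplus>\<^bsub>M (n - 1)\<^esub> (X n (d (n + 1) (H n x)) \<oplus>\<^bsub>M (n - 1)\<^esub> X n (G n (F n h)))))"
    by (simp add: X_G_F N_ac)
  also have "\<dots> = F' (n - 1) (d' n x)"
    by (simp only: MC X_eq) (simp add: F'_def d'_def N_ac X_add flip: X_def)
  finally show ?thesis .
qed

text \<open>By \<open>d'_S\<close> and \<open>1 + S H \<delta> = S\<close>, the right-hand side is
  \<open>S (1 + d H + H d + G F X H)\<close>, that is \<open>S G (F + F X H)\<close>.\<close>

lemma G'_F':
  assumes x[simp]: "x \<in> carrier (M n)"
  shows "G' n (F' n x) = x \<oplus>\<^bsub>M n\<^esub> (d' (n + 1) (H' n x) \<oplus>\<^bsub>M n\<^esub> H' (n - 1) (d' n x))"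
proof -
  have "x \<oplus>\<^bsub>M n\<^esub> (d' (n + 1) (H' n x) \<oplus>\<^bsub>M n\<^esub> H' (n - 1) (d' n x)) =
    (x \<oplus>\<^bsub>M n\<^esub> S n (H (n - 1) (\<delta> n x))) \<oplus>\<^bsub>M n\<^esub>
    S n (d (n + 1) (H n x) \<oplus>\<^bsub>M n\<^esub> (G n (F n (\<delta> (n + 1) (S (n + 1) (H n x)))) \<oplus>\<^bsub>M n\<^esub> H (n - 1) (d n x)))"
    by (simp add: H'_def d'_S) (simp add: d'_def M_ac)
  also have "\<dots> = S n (G n (F n x) \<oplus>\<^bsub>M n\<^esub> G n (F n (\<delta> (n + 1) (S (n + 1) (H n x)))))"
    unfolding S_right[OF x, symmetric] by (simp add: G_F M_ac)
  also have "\<dots> = G' n (F' n x)"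
    by (simp add: G'_def F'_def)
  finally show ?thesis by simp
qed

end


subsection \<open>The second homotopy\<close>

text \<open>Write \<open>[e, L]\<close> for \<open>e L + L e\<close>. Combining
  \<open>\<phi>_r\<close> with \<open>\<phi>_\<phi>\<close> gives
  \<open>(1 - r) \<phi> = (1 - r) + [e, J]\<close> for an explicit \<open>J\<close>. The inverse
  \<open>v\<close> of \<open>1 - r\<close> commutes with \<open>e\<close>, so applying it leaves
  \<open>\<phi> = 1 + [e, v J]\<close>.\<close>

lemma (in complete_graded_group) homotopic_id_of_perturbed_idempotent:
  assumes maps: "filtered_map M F M F 0 (-1) e" "filtered_map M F M F 0 0 \<phi>"
      "filtered_map M F M F 0 1 L" "filtered_map M F M F 0 1 K" "filtered_map M F M F 1 0 r"
    and e_e: "\<And>n y. y \<in> carrier (M n) \<Longrightarrow> e (n - 1) (e n y) = \<zero>\<^bsub>M (n - 2)\<^esub>"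
    and e_\<phi>: "\<And>n y. y \<in> carrier (M n) \<Longrightarrow> e n (\<phi> n y) = \<phi> (n - 1) (e n y)"
    and \<phi>_r: "\<And>n y. y \<in> carrier (M n) \<Longrightarrow>
      \<phi> n y \<oplus>\<^bsub>M n\<^esub> r n y = y \<oplus>\<^bsub>M n\<^esub> (e (n + 1) (L n y) \<oplus>\<^bsub>M n\<^esub> L (n - 1) (e n y))"
    and \<phi>_\<phi>: "\<And>n y. y \<in> carrier (M n) \<Longrightarrow>
      \<phi> n (\<phi> n y) = \<phi> n y \<oplus>\<^bsub>M n\<^esub> (e (n + 1) (K n y) \<oplus>\<^bsub>M n\<^esub> K (n - 1) (e n y))"
  shows "\<exists>h. filtered_map M F M F 0 1 h \<and> (\<forall>n. \<forall>y\<in>carrier (M n).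
    \<phi> n y = y \<oplus>\<^bsub>M n\<^esub> (e (n + 1) (h n y) \<oplus>\<^bsub>M n\<^esub> h (n - 1) (e n y)))"
proof -
  obtain v where v: "filtered_map M F M F 0 0 v"
    and v_left: "\<And>n y. y \<in> carrier (M n) \<Longrightarrow> v n y = y \<oplus>\<^bsub>M n\<^esub> r n (v n y)"
    and v_right: "\<And>n y. y \<in> carrier (M n) \<Longrightarrow> v n y = y \<oplus>\<^bsub>M n\<^esub> v n (r n y)"
    using geometric_series[OF maps(5)] by blast
  interpret e: filtered_map M F M F 0 "-1" e by fact
  interpret \<phi>: filtered_map M F M F 0 0 \<phi> by fact
  interpret L: filtered_map M F M F 0 1 L by fact
  interpret K: filtered_map M F M F 0 1 K by fact
  interpret r: filtered_map M F M F 1 0 r by fact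
  interpret v: filtered_map M F M F 0 0 v by fact
  note [simp] = e.closed \<phi>.closed L.closed K.closed r.closed v.closed
  note L_zero = L.hom.hom_zero[of "n - 2" for n, simplified]
  \<comment> \<open>Both \<open>\<phi>\<close> and \<open>[e, L]\<close> commute with
    \<open>e\<close>, the latter because both composites are \<open>e L e\<close>.\<close>
  have e_r: "e n (r n y) = r (n - 1) (e n y)" if y[simp]: "y \<in> carrier (M n)" for n y
  proof -
    have "e n (\<phi> n y \<oplus>\<^bsub>M n\<^esub> r n y) = \<phi> (n - 1) (e n y) \<oplus>\<^bsub>M (n - 1)\<^esub> r (n - 1) (e n y)"
      using e_e[of "L n y" "n + 1"] by (simp add: \<phi>_r e_e L_zero)
    then show ?thesis
      by (simp add: e_\<phi>)
  qed
  have e_v: "e n (v n y) = v (n - 1) (e n y)" if y[simp]: "y \<in> carrier (M n)" for n y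
  proof -
    \<comment> \<open>The element \<open>w\<close> satisfies \<open>w = e y + r w\<close>. Applying
      \<open>v\<close> and cancelling \<open>v r w\<close> against \<open>v w = w + v r w\<close>
      identifies it as \<open>v e y\<close>.\<close>
    define w where "w = e n (v n y)"
    have w[simp]: "w \<in> carrier (M (n - 1))"
      by (simp add: w_def)
    have "w = e n (y \<oplus>\<^bsub>M n\<^esub> r n (v n y))"
      using v_left[OF y] by (simp add: w_def)
    then have "w = e n y \<oplus>\<^bsub>M (n - 1)\<^esub> r (n - 1) w"
      by (simp add: e_r w_def)
    then have "v (n - 1) w = v (n - 1) (e n y \<oplus>\<^bsub>M (n - 1)\<^esub> r (n - 1) w)"
      by simp
    then show ?thesis
      using v_right[OF w] by (simp add: w_def)
  qed
  \<comment> \<open>Precomposing \<open>\<phi>_r\<close> with \<open>\<phi>\<close> and comparing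
    with \<open>\<phi>_\<phi>\<close> yields \<open>r \<phi> = [e, L \<phi>] - [e, K]\<close>.
    Substituting this into \<open>\<phi>_r\<close> produces the combination
    \<open>K + L - L \<phi>\<close>.\<close>
  define J where "J n y = (K n y \<oplus>\<^bsub>M (n + 1)\<^esub> L n y) \<ominus>\<^bsub>M (n + 1)\<^esub> L n (\<phi> n y)" for n y
  interpret J: filtered_map M F M F 0 1 J
    unfolding J_def by (intro filtered_map_diff filtered_map_add maps(3,4) refl
        filtered_map_comp[OF maps(2,3)]) simp_all
  note [simp] = J.closed
  have J_add: "J n y \<oplus>\<^bsub>M (n + 1)\<^esub> L n (\<phi> n y) = K n y \<oplus>\<^bsub>M (n + 1)\<^esub> L n y"
    if "y \<in> carrier (M n)" for n y
    using that by (simp add: J_def group.minus_add_cancel)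
  have key: "\<phi> n y \<oplus>\<^bsub>M n\<^esub> r n y =
      y \<oplus>\<^bsub>M n\<^esub> (r n (\<phi> n y) \<oplus>\<^bsub>M n\<^esub> (e (n + 1) (J n y) \<oplus>\<^bsub>M n\<^esub> J (n - 1) (e n y)))"
    if y[simp]: "y \<in> carrier (M n)" for n y
  proof -
    \<comment> \<open>This is \<open>[e, L \<phi>]\<close> at \<open>y\<close>. It is added to both
      sides and cancelled at the end, which avoids subtraction; \<open>c_eq\<close> is its second
      expression, \<open>[e, K] + r \<phi>\<close>.\<close>
    define c where "c = e (n + 1) (L n (\<phi> n y)) \<oplus>\<^bsub>M n\<^esub> L (n - 1) (\<phi> (n - 1) (e n y))"
    have c[simp]: "c \<in> carrier (M n)"
      by (simp add: c_def)
    have "\<phi> n y \<oplus>\<^bsub>M n\<^esub> c = \<phi> n (\<phi> n y) \<oplus>\<^bsub>M n\<^esub> r n (\<phi> n y)"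
      by (simp add: \<phi>_r e_\<phi> c_def)
    also have "\<dots> = \<phi> n y \<oplus>\<^bsub>M n\<^esub>
        (e (n + 1) (K n y) \<oplus>\<^bsub>M n\<^esub> (K (n - 1) (e n y) \<oplus>\<^bsub>M n\<^esub> r n (\<phi> n y)))"
      by (simp add: \<phi>_\<phi> group.a_ac)
    finally have c_eq: "c = e (n + 1) (K n y) \<oplus>\<^bsub>M n\<^esub> (K (n - 1) (e n y) \<oplus>\<^bsub>M n\<^esub> r n (\<phi> n y))"
      by simp
    have "(e (n + 1) (J n y) \<oplus>\<^bsub>M n\<^esub> J (n - 1) (e n y)) \<oplus>\<^bsub>M n\<^esub> c =
        e (n + 1) (J n y \<oplus>\<^bsub>M (n + 1)\<^esub> L n (\<phi> n y)) \<oplus>\<^bsub>M n\<^esub>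
        (J (n - 1) (e n y) \<oplus>\<^bsub>M n\<^esub> L (n - 1) (\<phi> (n - 1) (e n y)))"
      by (simp add: c_def group.a_ac)
    also have "\<dots> = e (n + 1) (K n y \<oplus>\<^bsub>M (n + 1)\<^esub> L n y) \<oplus>\<^bsub>M n\<^esub>
        (K (n - 1) (e n y) \<oplus>\<^bsub>M n\<^esub> L (n - 1) (e n y))"
      using J_add[of y n] J_add[of "e n y" "n - 1"] by simp
    finally have J_c: "(e (n + 1) (J n y) \<oplus>\<^bsub>M n\<^esub> J (n - 1) (e n y)) \<oplus>\<^bsub>M n\<^esub> c = \<dots>" .
    have "(\<phi> n y \<oplus>\<^bsub>M n\<^esub> r n y) \<oplus>\<^bsub>M n\<^esub> c =
        y \<oplus>\<^bsub>M n\<^esub> (r n (\<phi> n y) \<oplus>\<^bsub>M n\<^esub> (e (n + 1) (K n y \<oplus>\<^bsub>M (n + 1)\<^esub> L n y) \<oplus>\<^bsub>M n\<^esub>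
        (K (n - 1) (e n y) \<oplus>\<^bsub>M n\<^esub> L (n - 1) (e n y))))"
      by (simp add: \<phi>_r c_eq group.a_ac)
    also have "\<dots> = (y \<oplus>\<^bsub>M n\<^esub> (r n (\<phi> n y) \<oplus>\<^bsub>M n\<^esub>
        (e (n + 1) (J n y) \<oplus>\<^bsub>M n\<^esub> J (n - 1) (e n y)))) \<oplus>\<^bsub>M n\<^esub> c"
      by (simp only: J_c[symmetric]) (simp add: group.a_assoc)
    finally show ?thesis
      by (subst (asm) group.add.right_cancel) simp_all
  qed
  have "\<phi> n y = y \<oplus>\<^bsub>M n\<^esub> (e (n + 1) (v (n + 1) (J n y)) \<oplus>\<^bsub>M n\<^esub> v n (J (n - 1) (e n y)))"
    if y[simp]: "y \<in> carrier (M n)" for n y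
  proof -
    \<comment> \<open>The terms that \<open>v = 1 + v r\<close> produces on either side when
      \<open>v\<close> is applied to \<open>key\<close>.\<close>
    define c where "c = v n (r n y) \<oplus>\<^bsub>M n\<^esub> v n (r n (\<phi> n y))"
    have "\<phi> n y \<oplus>\<^bsub>M n\<^esub> c = v n (\<phi> n y \<oplus>\<^bsub>M n\<^esub> r n y)"
      using v_right[of "\<phi> n y" n] by (simp add: c_def group.a_ac)
    also have "\<dots> = (y \<oplus>\<^bsub>M n\<^esub> (e (n + 1) (v (n + 1) (J n y)) \<oplus>\<^bsub>M n\<^esub> v n (J (n - 1) (e n y)))) \<oplus>\<^bsub>M n\<^esub> c"
      using v_right[of y n] by (simp add: key c_def e_v group.a_ac)
    finally show ?thesis
      by (simp add: c_def)
  qed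
  moreover have "filtered_map M F M F 0 1 (\<lambda>n y. v (n + 1) (J n y))"
    by (rule filtered_map_comp[OF J.filtered_map_axioms v]) simp_all
  ultimately show ?thesis
    by (intro exI[of _ "\<lambda>n y. v (n + 1) (J n y)"]) simp
qed


text \<open>Applies the preceding lemma to \<open>\<phi> = F' G'\<close> and the differential
  \<open>e'\<close>. The relation \<open>\<phi> \<phi> = \<phi> + [e', K]\<close> comes from
  inserting \<open>G' F' = 1 + d' H' + H' d'\<close> between \<open>F'\<close> and
  \<open>G'\<close>.\<close>

lemma (in homotopy_perturbation) F'_G':
  assumes "complete_graded_group N FN"
    and L: "filtered_map N FN N FN 0 1 L"
    and F_G: "\<And>n y. y \<in> carrier (N n) \<Longrightarrow>
      F n (G n y) = y \<oplus>\<^bsub>N n\<^esub> (e (n + 1) (L n y) \<oplus>\<^bsub>N n\<^esub> L (n - 1) (e n y))"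
  shows "\<exists>h. filtered_map N FN N FN 0 1 h \<and> (\<forall>n. \<forall>y\<in>carrier (N n).
    F' n (G' n y) = y \<oplus>\<^bsub>N n\<^esub> (e' (n + 1) (h n y) \<oplus>\<^bsub>N n\<^esub> h (n - 1) (e' n y)))"
proof -
  interpret N: complete_graded_group N FN by fact
  interpret L: filtered_map N FN N FN 0 1 L by fact
  note [simp] = L.closed
  \<comment> \<open>\<open>\<xi>\<close>, \<open>a\<close> and \<open>b\<close> are the corrections
    in \<open>e' = e + \<xi>\<close>, \<open>G' = G + a\<close> and
    \<open>F' = F + b\<close>.\<close>
  define \<xi> where "\<xi> n y = F (n - 1) (\<delta> n (S n (G n y)))" for n y
  have e'_eq: "e' n y = e n y \<oplus>\<^bsub>N (n - 1)\<^esub> \<xi> n y" for n y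
    by (simp add: e'_def \<xi>_def)
  define a where "a n y = H (n - 1) (\<delta> n (S n (G n y)))" for n y
  define b where "b n x = F n (\<delta> (n + 1) (S (n + 1) (H n x)))" for n x
  have \<xi>: "filtered_map N FN N FN 1 (-1) \<xi>" and a: "filtered_map N FN M FM 1 0 a"
    and b: "filtered_map M FM N FN 1 0 b"
    unfolding \<xi>_def a_def b_def by (rule e_correction_map G_correction_map F_correction_map)+
  interpret \<xi>: filtered_map N FN N FN 1 "-1" \<xi> by fact
  interpret a: filtered_map N FN M FM 1 0 a by fact
  interpret b: filtered_map M FM N FN 1 0 b by fact
  note [simp] = \<xi>.closed a.closed b.closed
  \<comment> \<open>Chosen so that \<open>F' G' + r = 1 + e' L + L e'\<close>: the first bracket is
    the change of \<open>e L + L e\<close>, the second is \<open>F' G' - F G\<close>. Every summand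
    has a small factor, hence \<open>r\<close> has shift one.\<close>
  define r where "r n y = (\<xi> (n + 1) (L n y) \<oplus>\<^bsub>N n\<^esub> L (n - 1) (\<xi> n y)) \<ominus>\<^bsub>N n\<^esub>
    (b n (G n y) \<oplus>\<^bsub>N n\<^esub> F' n (a n y))" for n y
  have r: "filtered_map N FN N FN 1 0 r"
    unfolding r_def
    by (intro filtered_map_diff filtered_map_add filtered_map_comp[OF L \<xi>]
        filtered_map_comp[OF \<xi> L] filtered_map_comp[OF G.filtered_map_axioms b]
        filtered_map_comp[OF a F'.filtered_map_axioms]) simp_all
  show ?thesis
  proof (rule N.homotopic_id_of_perturbed_idempotent[OF e'.filtered_map_axioms _ L _ r])
    show "filtered_map N FN N FN 0 0 (\<lambda>n y. F' n (G' n y))"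
      by (rule filtered_map_comp[OF G'.filtered_map_axioms F'.filtered_map_axioms]) simp_all
    \<comment> \<open>The homotopy \<open>K\<close> from \<open>\<phi> \<phi>\<close> to
      \<open>\<phi>\<close> is \<open>F' H' G'\<close>.\<close>
    show "filtered_map N FN N FN 0 1 (\<lambda>n y. F' (n + 1) (H' n (G' n y)))"
      by (rule filtered_map_comp[OF filtered_map_comp[OF G'.filtered_map_axioms
              H'.filtered_map_axioms] F'.filtered_map_axioms]) simp_all
  next
    fix n y assume y[simp]: "y \<in> carrier (N n)"
    show "e' (n - 1) (e' n y) = \<zero>\<^bsub>N (n - 2)\<^esub>"
      by (simp add: e'_e')
    show "e' n (F' n (G' n y)) = F' (n - 1) (G' (n - 1) (e' n y))"
      by (simp add: e'_F' d'_G')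
    have "F' n (G' n y) = F n (G n y) \<oplus>\<^bsub>N n\<^esub> (b n (G n y) \<oplus>\<^bsub>N n\<^esub> F' n (a n y))"
      by (simp add: G'_eq flip: a_def) (simp add: F'_def N_ac flip: b_def)
    moreover have "(b n (G n y) \<oplus>\<^bsub>N n\<^esub> F' n (a n y)) \<oplus>\<^bsub>N n\<^esub> r n y =
        \<xi> (n + 1) (L n y) \<oplus>\<^bsub>N n\<^esub> L (n - 1) (\<xi> n y)"
      by (simp add: r_def e.dom.group.minus_add_cancel
          e.dom.group.a_comm[of "b n (G n y) \<oplus>\<^bsub>N n\<^esub> F' n (a n y)"])
    moreover have "r n y \<in> carrier (N n)"
      by (simp add: r_def)
    ultimately have "F' n (G' n y) \<oplus>\<^bsub>N n\<^esub> r n y =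
        F n (G n y) \<oplus>\<^bsub>N n\<^esub> (\<xi> (n + 1) (L n y) \<oplus>\<^bsub>N n\<^esub> L (n - 1) (\<xi> n y))"
      by (simp add: e.dom.group.a_assoc)
    then show "F' n (G' n y) \<oplus>\<^bsub>N n\<^esub> r n y =
        y \<oplus>\<^bsub>N n\<^esub> (e' (n + 1) (L n y) \<oplus>\<^bsub>N n\<^esub> L (n - 1) (e' n y))"
      by (simp add: F_G e'_eq N_ac)
    show "F' n (G' n (F' n (G' n y))) = F' n (G' n y) \<oplus>\<^bsub>N n\<^esub>
        (e' (n + 1) (F' (n + 1) (H' n (G' n y))) \<oplus>\<^bsub>N n\<^esub>
         F' (n - 1 + 1) (H' (n - 1) (G' (n - 1) (e' n y))))"
      using e'_F'[of "H' n (G' n y)" "n + 1"] by (simp add: G'_F' d'_G')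
  qed
qed

section \<open>Assembly: from filtered complexes to the perturbation formulas and back\<close>

theorem mainTheorem4:
  fixes M :: "int \<Rightarrow> ('a, 'm) ring_scheme" and dM dM' :: "int \<Rightarrow> 'a \<Rightarrow> 'a"
    and FM :: "nat \<Rightarrow> int \<Rightarrow> 'a set"
    and N :: "int \<Rightarrow> ('b, 'n) ring_scheme" and dN :: "int \<Rightarrow> 'b \<Rightarrow> 'b"
    and FN :: "nat \<Rightarrow> int \<Rightarrow> 'b set"
    and F :: "int \<Rightarrow> 'a \<Rightarrow> 'b" and G :: "int \<Rightarrow> 'b \<Rightarrow> 'a"
  assumes "complete_filtered_complex M dM FM"
    and "complete_filtered_complex N dN FN"
    and "filtered_chain_map M dM FM N dN FN F"
    and "filtered_chain_map N dN FN M dM FM G"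
    and "filtered_homotopy_inverse M dM FM N dN FN F G"
    and "is_differential_perturbation M FM dM dM'"
  shows "\<exists>dN' F' G'.
    is_differential_perturbation N FN dN dN' \<and>
    is_perturbation M FM N FN 0 F F' \<and>
    is_perturbation N FN M FM 0 G G' \<and>
    filtered_chain_map M dM' FM N dN' FN F' \<and>
    filtered_chain_map N dN' FN M dM' FM G' \<and>
    filtered_homotopy_inverse M dM' FM N dN' FN F' G'"
proof -
  interpret cM: complete_filtered_complex M dM FM by fact
  interpret cN: complete_filtered_complex N dN FN by fact
  interpret M: complete_graded_group M FM
    by (rule cM.complete_graded_group)
  interpret N: complete_graded_group N FN
    by (rule cN.complete_graded_group)
  note gM = M.filtered_graded_group_axioms and gN = N.filtered_graded_group_axioms
  note iff = filtered_map_iff[OF gM gM] filtered_map_iff[OF gM gN] filtered_map_iff[OF gN gM]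
    filtered_map_iff[OF gN gN]
  have dM: "filtered_map M FM M FM 0 (-1) dM" and dN: "filtered_map N FN N FN 0 (-1) dN"
    using cM.differential cM.filtration_differential cN.differential cN.filtration_differential
    by (simp_all add: iff is_differential_def)
  have F: "filtered_map M FM N FN 0 0 F" and G: "filtered_map N FN M FM 0 0 G"
    using assms(3,4) by (simp_all add: iff filtered_chain_map_def)
  have idM: "filtered_map M FM M FM 0 0 (\<lambda>n. id)" and idN: "filtered_map N FN N FN 0 0 (\<lambda>n. id)"
    using gM gN by (simp_all add: filtered_mapI)
  have GF: "filtered_map M FM M FM 0 0 (\<lambda>n. G n \<circ> F n)"
    unfolding comp_def by (rule filtered_map_comp[OF F G]) simp_all
  have FG: "filtered_map N FN N FN 0 0 (\<lambda>n. F n \<circ> G n)"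
    unfolding comp_def by (rule filtered_map_comp[OF G F]) simp_all
  obtain H where H: "filtered_map M FM M FM 0 1 H" and G_F: "\<And>n x. x \<in> carrier (M n) \<Longrightarrow>
      G n (F n x) = x \<oplus>\<^bsub>M n\<^esub> (dM (n + 1) (H n x) \<oplus>\<^bsub>M n\<^esub> H (n - 1) (dM n x))"
    using assms(5)
    by (auto simp: filtered_homotopy_inverse_def filtered_homotopic_iff[OF gM gM dM dM GF idM])
  obtain L where L: "filtered_map N FN N FN 0 1 L" and F_G: "\<And>n y. y \<in> carrier (N n) \<Longrightarrow>
      F n (G n y) = y \<oplus>\<^bsub>N n\<^esub> (dN (n + 1) (L n y) \<oplus>\<^bsub>N n\<^esub> L (n - 1) (dN n y))"
    using assms(5)
    by (auto simp: filtered_homotopy_inverse_def filtered_homotopic_iff[OF gN gN dN dN FG idN])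
  have pert: "is_perturbation M FM M FM (-1) dM dM'" and
    dM'_dM': "\<And>n x. x \<in> carrier (M n) \<Longrightarrow> dM' (n - 1) (dM' n x) = \<zero>\<^bsub>M (n - 2)\<^esub>"
    using assms(6) by (simp_all add: is_differential_perturbation_def is_differential_def)
  \<comment> \<open>The degree is written \<open>n + -1\<close> to agree with the instance
    \<open>k = -1\<close> of \<open>is_perturbationD\<close>.\<close>
  define \<delta> where "\<delta> n x = dM' n x \<ominus>\<^bsub>M (n + -1)\<^esub> dM n x" for n x
  have dM': "filtered_map M FM M FM 0 (-1) dM'" and \<delta>: "filtered_map M FM M FM 1 (-1) \<delta>"
    unfolding \<delta>_def using is_perturbationD[OF dM pert] .
  interpret dM: filtered_map M FM M FM 0 "-1" dM by (rule dM)
  interpret dM': filtered_map M FM M FM 0 "-1" dM' by (rule dM')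
  interpret \<delta>: filtered_map M FM M FM 1 "-1" \<delta> by (rule \<delta>)
  have dM'_eq: "dM' n x = dM n x \<oplus>\<^bsub>M (n - 1)\<^esub> \<delta> n x" if "x \<in> carrier (M n)" for n x
    using that by (simp add: \<delta>_def dM.closed dM'.closed M.group.minus_add_cancel
        M.group.a_comm[of "dM n x"])
  \<comment> \<open>\<open>H \<delta>\<close> has degree 0 and inherits shift one from
    \<open>\<delta>\<close>, so the geometric series applies to it.\<close>
  have "filtered_map M FM M FM 1 0 (\<lambda>n x. H (n - 1) (\<delta> n x))"
    by (rule filtered_map_comp[OF \<delta> H]) simp_all
  then obtain S where S: "filtered_map M FM M FM 0 0 S"
    and S_left: "\<And>n x. x \<in> carrier (M n) \<Longrightarrow> S n x = x \<oplus>\<^bsub>M n\<^esub> H (n - 1) (\<delta> n (S n x))"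
    and S_right: "\<And>n x. x \<in> carrier (M n) \<Longrightarrow> S n x = x \<oplus>\<^bsub>M n\<^esub> S n (H (n - 1) (\<delta> n x))"
    using M.geometric_series by blast
  interpret P: homotopy_perturbation M FM N FN dM \<delta> dN F G H S
  proof (intro homotopy_perturbation.intro homotopy_perturbation_axioms.intro dM \<delta> dN F G H S
      G_F S_left S_right)
    fix n y assume "y \<in> carrier (N n)"
    then show "dN (n - 1) (dN n y) = \<zero>\<^bsub>N (n - 2)\<^esub>" "dM n (G n y) = G (n - 1) (dN n y)"
      using cN.differential assms(4) by (simp_all add: is_differential_def filtered_chain_map_def)
  next
    fix n x assume x: "x \<in> carrier (M n)"
    then show "dN n (F n x) = F (n - 1) (dM n x)"
      using assms(3) by (simp add: filtered_chain_map_def)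
    \<comment> \<open>Expanding the square of \<open>dM + \<delta>\<close> and removing the square
      of \<open>dM\<close> leaves the Maurer-Cartan equation.\<close>
    have "dM' (n - 1) (dM' n x) = dM (n - 1) (dM n x) \<oplus>\<^bsub>M (n - 2)\<^esub>
        (dM (n - 1) (\<delta> n x) \<oplus>\<^bsub>M (n - 2)\<^esub> \<delta> (n - 1) (dM n x \<oplus>\<^bsub>M (n - 1)\<^esub> \<delta> n x))"
      using x by (simp add: dM'_eq dM.closed \<delta>.closed M.group.a_assoc)
    moreover have "dM (n - 1) (dM n x) = \<zero>\<^bsub>M (n - 2)\<^esub>"
      using x cM.differential by (simp add: is_differential_def)
    ultimately show "dM (n - 1) (\<delta> n x) \<oplus>\<^bsub>M (n - 2)\<^esub> \<delta> (n - 1) (dM n x \<oplus>\<^bsub>M (n - 1)\<^esub> \<delta> n x) =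
        \<zero>\<^bsub>M (n - 2)\<^esub>"
      using x dM'_dM'[OF x] by (simp add: dM.closed \<delta>.closed)
  qed
  \<comment> \<open>The two maps are identified on carriers only, which is all that the chain map
    and homotopy equations see.\<close>
  have d'_eq: "dM' n x = P.d' n x" if "x \<in> carrier (M n)" for n x
    using that by (simp add: dM'_eq P.d'_def)
  note e' = P.e'.filtered_map_axioms and F' = P.F'.filtered_map_axioms
    and G' = P.G'.filtered_map_axioms and H' = P.H'.filtered_map_axioms
  have G'F': "filtered_map M FM M FM 0 0 (\<lambda>n. P.G' n \<circ> P.F' n)"
    unfolding comp_def by (rule filtered_map_comp[OF F' G']) simp_all
  have F'G': "filtered_map N FN N FN 0 0 (\<lambda>n. P.F' n \<circ> P.G' n)"
    unfolding comp_def by (rule filtered_map_comp[OF G' F']) simp_all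
  show ?thesis
  proof (intro exI conjI)
    show "is_differential_perturbation N FN dN P.e'"
      by (simp add: is_differential_perturbation_def is_differential_def P.perturbations
          P.e'.graded P.e'_e')
    show "is_perturbation M FM N FN 0 F P.F'" "is_perturbation N FN M FM 0 G P.G'"
      by (rule P.perturbations)+
    show "filtered_chain_map M dM' FM N P.e' FN P.F'"
      using F' by (simp add: filtered_chain_map_def iff P.e'_F' d'_eq)
    show "filtered_chain_map N P.e' FN M dM' FM P.G'"
      using G' by (simp add: filtered_chain_map_def iff P.d'_G' d'_eq)
    have "filtered_homotopic M dM' FM M dM' FM (\<lambda>n. P.G' n \<circ> P.F' n) (\<lambda>n. id)"
      unfolding filtered_homotopic_iff[OF gM gM dM' dM' G'F' idM]
      using H' by (intro exI[of _ P.H']) (simp add: P.G'_F' d'_eq)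
    moreover have "filtered_homotopic N P.e' FN N P.e' FN (\<lambda>n. P.F' n \<circ> P.G' n) (\<lambda>n. id)"
      unfolding filtered_homotopic_iff[OF gN gN e' e' F'G' idN]
      using P.F'_G'[OF N.complete_graded_group_axioms L F_G] by simp
    ultimately show "filtered_homotopy_inverse M dM' FM N P.e' FN P.F' P.G'"
      by (simp add: filtered_homotopy_inverse_def)
  qed
qed

end
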